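(* Let $S$ be a nonempty admissible set and $m=\max(S)$. For every $j\in\{0,1,\dots,m\}$, $$(\Delta^j p_S)(0)=(-1)^{m+j}p_S(j).$$
   Context: For a permutation $\pi=\pi_1\cdots\pi_n\in\mathfrak S_n$, an index $1<i<n$ is a peak if $\pi_{i-1}<\pi_i>\pi_{i+1}$; $P(\pi)$ is the set of peaks of $\pi$, and $\mathcal P_S(n)=\{\pi\in\mathfrak S_n: P(\pi)=S\}$. A finite set $S$ of positive integers is admissible if $\mathcal P_S(n)\neq\emptyset$ for some $n$; equivalently $1\notin S$ and $S$ contains no two consecutive integers. Known fact (Billey–Burdzy–Sagan): for a nonempty admissible $S$ with $m=\max(S)$ there is a unique polynomial $p_S(x)$, of degree $m-1$ and integer-valued on integers, such that $|\mathcal P_S(n)|=p_S(n)2^{n-|S|-1}$ for all $n\ge m$; $p_S$ is called the peak polynomial of $S$. $\Delta$ is the forward difference operator, $(\Delta f)(x)=f(x+1)-f(x)$, $\Delta^0 f=f$, and $(\Delta^n f)(x)=(\Delta^{n-1}f)(x+1)-(\Delta^{n-1}f)(x)$. *)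

theory Defs
  imports
    Complex_Main
    "HOL-Combinatorics.Permutations"
    "HOL-Computational_Algebra.Polynomial"
begin

text \<open>
  A permutation of size n is a function that permutes \<open>{1..n}\<close>; its i-th letter is \<open>\<pi> i\<close>.
\<close>

definition peak_set :: "nat \<Rightarrow> (nat \<Rightarrow> nat) \<Rightarrow> nat set" where
  "peak_set n \<pi> = {i. 1 < i \<and> i < n \<and> \<pi> (i - 1) < \<pi> i \<and> \<pi> i > \<pi> (i + 1)}"

definition perms_with_peaks :: "nat set \<Rightarrow> nat \<Rightarrow> (nat \<Rightarrow> nat) set" where
  "perms_with_peaks S n = {\<pi>. \<pi> permutes {1..n} \<and> peak_set n \<pi> = S}"

definition admissible :: "nat set \<Rightarrow> bool" where
  "admissible S \<longleftrightarrow> finite S \<and> (\<forall>i\<in>S. 0 < i) \<and> (\<exists>n. perms_with_peaks S n \<noteq> {})"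

text \<open>
  The peak polynomial is the unique polynomial satisfying the counting identity (Billey, Burdzy
  and Sagan). It is meaningful only for nonempty admissible \<open>S\<close>; such an \<open>S\<close> contains neither 1
  nor two consecutive integers, so \<open>n \<ge> Max S \<ge> card S + 1\<close> and the subtraction in the exponent
  does not truncate. Its degree \<open>Max S - 1\<close> and its integrality on integers are consequences
  of the identity.
\<close>

definition peak_poly :: "nat set \<Rightarrow> real poly" where
  "peak_poly S = (THE p. \<forall>n \<ge> Max S.
     real (card (perms_with_peaks S n)) = poly p (real n) * 2 ^ (n - card S - 1))"

definition fwd_diff :: "(real \<Rightarrow> real) \<Rightarrow> real \<Rightarrow> real" where
  "fwd_diff f = (\<lambda>x. f (x + 1) - f x)"

end

theory Submission
  imports Defs "HOL-Combinatorics.Multiset_Permutations"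
begin

text \<open>
  Let \<open>T f j = \<Sum>i\<le>j. (-1)^i * (j choose i) * f i\<close>, an involution with
  \<open>\<Delta>^j f 0 = (-1)^j * T f j\<close>; with \<open>m = max S\<close> the claim
  is thus that \<open>T p\<^sub>S = (-1)^m p\<^sub>S\<close> on \<open>{0..m}\<close>.
  For \<open>k > m\<close> one has \<open>p\<^bsub>S \<union> {k}\<^esub> = (-1)^(k+1) * T p\<^sub>S - p\<^sub>S\<close> on \<open>{0..<k}\<close>, by induction on \<open>k\<close>:
  the step is the recursion of Billey, Burdzy and Sagan, and the base case \<open>k = m + 1\<close>, where the
  left-hand side vanishes because consecutive peaks are impossible, is the claim for \<open>S\<close>. Since \<open>T\<close>
  is an involution, the formula yields the claim for \<open>S \<union> {k}\<close> on \<open>{0..<k}\<close>; at \<open>k\<close> itself both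
  sides are 0.
\<close>


section \<open>The binomial transform and forward differences\<close>

text \<open>
  The sum \<open>\<Sum>i\<le>j. (-1)^i * (j choose i) * f i\<close>, given by the recursion that Pascal's rule implies.
\<close>

fun binomial_transform :: "(nat \<Rightarrow> real) \<Rightarrow> nat \<Rightarrow> real" where
  "binomial_transform f 0 = f 0"
| "binomial_transform f (Suc j) = binomial_transform f j - binomial_transform (\<lambda>i. f (Suc i)) j"

lemma binomial_transform_cong:
  "(\<And>i. i \<le> j \<Longrightarrow> f i = g i) \<Longrightarrow> binomial_transform f j = binomial_transform g j"
proof (induction j arbitrary: f g)
  case (Suc j)
  have "binomial_transform f j = binomial_transform g j"
    using Suc.prems by (intro Suc.IH) auto
  moreover have "binomial_transform (\<lambda>i. f (Suc i)) j = binomial_transform (\<lambda>i. g (Suc i)) j"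
    using Suc.prems by (intro Suc.IH) auto
  ultimately show ?case by simp
qed simp

lemma binomial_transform_diff:
  "binomial_transform (\<lambda>i. f i - g i) j = binomial_transform f j - binomial_transform g j"
  by (induction j arbitrary: f g) auto

lemma binomial_transform_scale:
  "binomial_transform (\<lambda>i. c * f i) j = c * binomial_transform f j"
  by (induction j arbitrary: f) (auto simp: algebra_simps)

text \<open>Write \<open>T\<close> for the transform. Unfolding both layers at \<open>Suc j\<close>
  leaves \<open>T (T f) j - T (T f - T (f o Suc)) j\<close>, which is
  \<open>T (T (f o Suc)) j\<close> by linearity, and the induction hypothesis applies to
  \<open>f o Suc\<close>.\<close>

lemma binomial_transform_involution:
  "binomial_transform (binomial_transform f) j = f j"
  by (induction j arbitrary: f) (auto simp: binomial_transform_diff)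

text \<open>\<open>fwd_diff\<close> subtracts in the opposite order to the recursion of the
  transform, so each step contributes a factor -1. The step also needs the claim at
  \<open>x + 1\<close>, hence the varying \<open>x\<close>.\<close>

lemma fwd_diff_funpow_eq_binomial_transform:
  "(fwd_diff ^^ j) f x = (-1) ^ j * binomial_transform (\<lambda>i. f (x + real i)) j"
proof (induction j arbitrary: x)
  case (Suc j)
  have "(fwd_diff ^^ Suc j) f x = (fwd_diff ^^ j) f (x + 1) - (fwd_diff ^^ j) f x"
    by (simp add: fwd_diff_def)
  also have "\<dots> = (-1) ^ Suc j * binomial_transform (\<lambda>i. f (x + real i)) (Suc j)"
    by (simp add: Suc.IH algebra_simps)
  finally show ?case .
qed simp

text \<open>One unfolding replaces \<open>p(x)\<close> by \<open>p(x) - p(x + 1)\<close>, where the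
  leading terms cancel; a constant becomes 0.\<close>

lemma binomial_transform_poly_eq_0:
  "degree p < j \<Longrightarrow> binomial_transform (\<lambda>i. poly p (real i)) j = 0"
proof (induction j arbitrary: p)
  case (Suc j)
  define q where "q = p - pcompose p [:1, 1:]"
  have q: "binomial_transform (\<lambda>i. poly p (real i)) (Suc j) = binomial_transform (\<lambda>i. poly q (real i)) j"
    by (simp add: q_def poly_pcompose binomial_transform_diff)
  show ?case
  proof (cases "degree p = 0")
    case True
    then obtain a where "p = [:a:]" by (rule degree_eq_zeroE)
    then have "q = 0" by (simp add: q_def)
    \<comment> \<open>Scaling by 0 shows that the transform of the zero function vanishes.\<close>
    then show ?thesis
      using binomial_transform_scale[of 0 "\<lambda>_. 0" j] q by simp
  next
    case False
    have deg: "degree (pcompose p [:1, 1:]) = degree p"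
      by (simp add: degree_pcompose)
    have "lead_coeff (pcompose p [:1, 1:]) = lead_coeff p"
      by (simp add: lead_coeff_comp)
    then have "coeff q (degree p) = 0"
      by (simp add: q_def deg)
    moreover have "degree q \<le> degree p"
      unfolding q_def by (rule degree_diff_le) (simp_all add: deg)
    ultimately have "degree q < degree p"
      using False by (metis coeff_0 degree_0 leading_coeff_0_iff le_neq_implies_less)
    then show ?thesis
      using Suc q by simp
  qed
qed simp

section \<open>Words and their peaks\<close>

text \<open>Peak positions are counted from 1, list indices from 0.\<close>

definition peaks :: "nat list \<Rightarrow> nat set" where
  "peaks xs = {i. 1 < i \<and> i < length xs \<and> xs ! (i - 2) < xs ! (i - 1) \<and> xs ! i < xs ! (i - 1)}"

text \<open>The alphabet is arbitrary because cutting a permutation leaves words on two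
  complementary sets of letters.\<close>

definition words_with_peaks :: "nat set \<Rightarrow> nat set \<Rightarrow> nat list set" where
  "words_with_peaks A S = {xs \<in> permutations_of_set A. peaks xs = S}"

lemma finite_words_with_peaks [simp]: "finite (words_with_peaks A S)"
  by (simp add: words_with_peaks_def)

lemma words_with_peaksI:
  "set xs = A \<Longrightarrow> distinct xs \<Longrightarrow> peaks xs = S \<Longrightarrow> xs \<in> words_with_peaks A S"
  by (auto simp: words_with_peaks_def)

lemma words_with_peaksD:
  assumes "xs \<in> words_with_peaks A S"
  shows "set xs = A" "distinct xs" "peaks xs = S" "length xs = card A"
  using assms by (auto simp: words_with_peaks_def permutations_of_set_def distinct_card)

lemma peaks_bounds: "i \<in> peaks xs \<Longrightarrow> 1 < i \<and> i < length xs"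
  by (auto simp: peaks_def)

lemma peaks_not_consecutive: "i \<in> peaks xs \<Longrightarrow> Suc i \<notin> peaks xs"
  by (auto simp: peaks_def)

lemma peaks_append_left: "i < length xs \<Longrightarrow> i \<in> peaks (xs @ ys) \<longleftrightarrow> i \<in> peaks xs"
  by (auto simp: peaks_def nth_append)

text \<open>The first letter of \<open>ys\<close> is excluded: the last letter of \<open>xs\<close>
  can make it a peak.\<close>

lemma peaks_append_right:
  assumes "0 < i"
  shows "length xs + Suc i \<in> peaks (xs @ ys) \<longleftrightarrow> Suc i \<in> peaks ys"
proof -
  obtain i' where "i = Suc i'" using assms by (cases i) auto
  then show ?thesis by (simp add: peaks_def nth_append)
qed

text \<open>Being a peak depends on three consecutive letters. These lie in one of the two words
  unless the middle one is adjacent to the cut, so only the two positions at the cut are left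
  free.\<close>

lemma peaks_append_no_peaks_iff:
  "peaks (xs @ ys) \<subseteq> {length xs, Suc (length xs)} \<union> S \<and> peaks (xs @ ys) \<inter> {..<length xs} = S
     \<longleftrightarrow> peaks xs = S \<and> peaks ys = {}"
  (is "?L \<longleftrightarrow> ?R")
proof
  assume L: ?L
  have "peaks xs = S"
    using L peaks_append_left[of _ xs ys] peaks_bounds[of _ xs] by blast
  moreover have False if "i \<in> peaks ys" for i
  proof -
    from peaks_bounds[OF that] have "0 < i - 1" "Suc (i - 1) = i" by auto
    then have "length xs + i \<in> peaks (xs @ ys)" "1 < i"
      using that peaks_append_right[of "i - 1" xs ys] by auto
    moreover have "S \<subseteq> {..<length xs}" using L by blast
    ultimately show False using L by force
  qed
  ultimately show ?R by blast
next
  assume R: ?R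
  have "i \<in> {length xs, Suc (length xs)} \<union> S" if "i \<in> peaks (xs @ ys)" for i
  proof -
    consider "i < length xs" | "i \<in> {length xs, Suc (length xs)}"
      | "0 < i - Suc (length xs)" "i = length xs + Suc (i - Suc (length xs))"
      by fastforce
    then show ?thesis
      using R that peaks_append_left[of i xs ys] peaks_append_right[of "i - Suc (length xs)" xs ys]
      by cases auto
  qed
  moreover have "peaks (xs @ ys) \<inter> {..<length xs} = S"
    using R peaks_append_left[of _ xs ys] peaks_bounds[of _ xs] by blast
  ultimately show ?L by blast
qed

section \<open>Order-preserving relabelling of letters\<close>

lemma peaks_map_strict_mono:
  assumes "strict_mono_on (set xs) f"
  shows "peaks (map f xs) = peaks xs"
proof -
  have less: "f (xs ! i) < f (xs ! j) \<longleftrightarrow> xs ! i < xs ! j" if "i < length xs" "j < length xs" for i j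
    using strict_mono_on_less[OF assms] that by simp
  show ?thesis
    by (auto simp: peaks_def less)
qed

lemma card_words_with_peaks_le:
  assumes "strict_mono_on A f"
  shows "card (words_with_peaks A S) \<le> card (words_with_peaks (f ` A) S)"
proof (rule card_inj_on_le)
  have inj: "inj_on f A"
    using assms by (rule strict_mono_on_imp_inj_on)
  show "inj_on (map f) (words_with_peaks A S)"
    by (rule inj_on_subset[OF inj_on_mapI[of f "{xs. set xs = A}"]])
       (use inj in \<open>auto dest: words_with_peaksD(1)\<close>)
  show "map f ` words_with_peaks A S \<subseteq> words_with_peaks (f ` A) S"
  proof
    fix ys assume "ys \<in> map f ` words_with_peaks A S"
    then obtain xs where xs: "xs \<in> words_with_peaks A S" "ys = map f xs" by blast
    note D = words_with_peaksD[OF xs(1)]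
    show "ys \<in> words_with_peaks (f ` A) S"
      using D assms inj xs(2)
      by (intro words_with_peaksI) (auto simp: distinct_map peaks_map_strict_mono)
  qed
qed simp

text \<open>The inverse of \<open>f\<close> on its image is strictly monotone too, so the inequality
  holds in both directions.\<close>

lemma card_words_with_peaks_strict_mono:
  assumes "strict_mono_on A f"
  shows "card (words_with_peaks (f ` A) S) = card (words_with_peaks A S)"
proof (rule antisym)
  have inj: "inj_on f A"
    using assms by (rule strict_mono_on_imp_inj_on)
  have "strict_mono_on (f ` A) (inv_into A f)"
    using strict_mono_on_less[OF assms] inj by (auto simp: strict_mono_on_def)
  from card_words_with_peaks_le[OF this, of S]
  show "card (words_with_peaks (f ` A) S) \<le> card (words_with_peaks A S)"
    using inj by (simp add: image_image)
qed (rule card_words_with_peaks_le[OF assms])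

text \<open>Every finite set of naturals is order-isomorphic to the initial segment of its
  size.\<close>

lemma card_words_with_peaks_cong:
  assumes "finite A" "finite B" "card A = card B"
  shows "card (words_with_peaks A S) = card (words_with_peaks B S)"
proof -
  have *: "card (words_with_peaks M S) = card (words_with_peaks {..<card M} S)" if "finite M" for M
    using ex_bij_betw_strict_mono_card[OF that] card_words_with_peaks_strict_mono
    by (metis bij_betw_imp_surj_on)
  show ?thesis
    using *[OF assms(1)] *[OF assms(2)] assms(3) by simp
qed

section \<open>Words without peaks\<close>

text \<open>The maximum of a word without peaks is its first or its last letter.\<close>

lemma words_with_no_peaks_insert:
  assumes "\<forall>a\<in>A. a < b" "A \<noteq> {}"
  shows "words_with_peaks (insert b A) {} =
           (#) b ` words_with_peaks A {} \<union> (\<lambda>xs. xs @ [b]) ` words_with_peaks A {}" (is "?L = ?R")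
proof (intro equalityI subsetI)
  fix xs assume "xs \<in> ?L"
  note D = words_with_peaksD[OF this]
  have less: "xs ! j < b" if "j < length xs" "xs ! j \<noteq> b" for j
    using that D(1) assms nth_mem[of j xs] by blast
  obtain i where i: "i < length xs" "xs ! i = b"
    using D(1) by (metis in_set_conv_nth insertI1)
  have other: "xs ! j < b" if "j < length xs" "j \<noteq> i" for j
    using less[of j] that D(2) i by (auto simp: nth_eq_iff_index_eq)
  have "i = 0 \<or> i = length xs - 1"
  proof (rule ccontr)
    assume "\<not> ?thesis"
    \<comment> \<open>List index \<open>i\<close> is position \<open>Suc i\<close>, and an inner
      maximum exceeds both neighbours.\<close>
    then have "Suc i \<in> peaks xs"
      using i other by (auto simp: peaks_def)
    then show False using D(3) by simp
  qed
  then show "xs \<in> ?R"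
  proof
    assume "i = 0"
    then obtain ys where ys: "xs = b # ys"
      using i by (metis length_greater_0_conv list.exhaust nth_Cons_0)
    have "b \<notin> A" using assms by blast
    have "peaks ys = {}"
      using D(3) peaks_append_no_peaks_iff[of "[b]" ys "{}"] by (simp add: ys)
    then have "ys \<in> words_with_peaks A {}"
      using D(1,2) ys \<open>b \<notin> A\<close> by (intro words_with_peaksI) auto
    then show ?thesis using ys by blast
  next
    assume "i = length xs - 1"
    then obtain ys where ys: "xs = ys @ [b]"
      using i by (metis append_butlast_last_id last_conv_nth length_0_conv less_nat_zero_code)
    have "b \<notin> A" using assms by blast
    have "peaks ys = {}"
      using D(3) peaks_append_left[of _ ys "[b]"] peaks_bounds[of _ ys] ys by blast
    then have "ys \<in> words_with_peaks A {}"
      using D(1,2) ys \<open>b \<notin> A\<close> by (intro words_with_peaksI) auto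
    then show ?thesis using ys by blast
  qed
next
  fix xs assume "xs \<in> ?R"
  then obtain ys where ys: "ys \<in> words_with_peaks A {}" and xs: "xs = b # ys \<or> xs = ys @ [b]"
    by blast
  note D = words_with_peaksD[OF ys]
  have nth: "ys ! j < b" if "j < length ys" for j
    using that D(1) assms nth_mem by blast
  have no: "\<not> (ys ! (i - 2) < ys ! (i - 1) \<and> ys ! i < ys ! (i - 1))" if "1 < i" "i < length ys" for i
    using D(3) that by (auto simp: peaks_def)
  have "peaks (b # ys) = {}"
  proof (rule ccontr)
    assume "peaks (b # ys) \<noteq> {}"
    then obtain i where i: "i \<in> peaks (b # ys)" by blast
    show False
    \<comment> \<open>Position 2 is the first letter of \<open>ys\<close>, preceded by the larger
      \<open>b\<close>; later positions are inner positions of \<open>ys\<close> shifted by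
      one.\<close>
    proof (cases "i = 2")
      case True
      have "ys ! 0 < b" using nth[of 0] peaks_bounds[OF i] by (cases ys) auto
      then show False using i True by (auto simp: peaks_def)
    next
      case False
      then obtain k where "i = Suc (Suc (Suc k))"
        using peaks_bounds[OF i] by (cases i rule: nat.exhaust; cases "i - 1"; cases "i - 2") auto
      then show False using i no[of "Suc (Suc k)"] by (auto simp: peaks_def)
    qed
  qed
  moreover have "peaks (ys @ [b]) = {}"
  proof (rule ccontr)
    assume "peaks (ys @ [b]) \<noteq> {}"
    then obtain i where i: "i \<in> peaks (ys @ [b])" by blast
    show False
    proof (cases "i = length ys")
      case True
      then have "i - 1 < length ys" using peaks_bounds[OF i] by linarith
      with i nth[OF this] True show False by (simp add: peaks_def nth_append)
    next
      case False
      then have "i \<in> peaks ys"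
        using i peaks_bounds[OF i] peaks_append_left[of i ys "[b]"] by auto
      then show False using D(3) by simp
    qed
  qed
  moreover have "b \<notin> A" using assms by blast
  ultimately show "xs \<in> ?L"
    using xs D by (intro words_with_peaksI) auto
qed

text \<open>A new largest letter can go to either end, which doubles the count. Only for empty
  \<open>A\<close> do the two ends coincide.\<close>

lemma card_words_with_no_peaks:
  assumes "finite A" "A \<noteq> {}"
  shows "card (words_with_peaks A {}) = 2 ^ (card A - 1)"
  using assms
proof (induction A rule: finite_linorder_max_induct)
  case (insert b A)
  have b: "b \<notin> A" using insert by blast
  show ?case
  proof (cases "A = {}")
    case True
    have "words_with_peaks {b} {} = {[b]}"
      by (auto simp: words_with_peaks_def peaks_def)
    then show ?thesis using True by simp
  next
    case False
    let ?W = "words_with_peaks A {}"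
    have "(#) b ` ?W \<inter> (\<lambda>xs. xs @ [b]) ` ?W = {}"
    proof -
      have False if "b # xs = ys @ [b]" "xs \<in> ?W" "ys \<in> ?W" for xs ys
        using that b False words_with_peaksD(1)[of ys A "{}"] by (cases ys) auto
      then show ?thesis by blast
    qed
    then have "card (words_with_peaks (insert b A) {}) = card ?W + card ?W"
      using words_with_no_peaks_insert[OF insert.hyps(2) False]
      by (simp add: card_Un_disjoint card_image inj_on_def)
    also have "\<dots> = 2 ^ card A"
      using insert False card_gt_0_iff[of A] by (simp flip: power_Suc mult_2)
    finally show ?thesis using b insert by simp
  qed
qed simp

section \<open>Splitting words and the counting recursion\<close>

text \<open>Cut after \<open>k\<close> letters: choose the set \<open>B\<close> of the first
  \<open>k\<close> letters, a word on \<open>B\<close> with peak set \<open>S\<close> and a word on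
  the rest without peaks. Both counts depend only on the number of letters.\<close>

lemma card_words_split:
  assumes "finite A" "k \<le> card A"
  shows "card {zs \<in> permutations_of_set A.
           peaks zs \<subseteq> {k, Suc k} \<union> S \<and> peaks zs \<inter> {..<k} = S} =
         (card A choose k) * card (words_with_peaks {..<k} S) * card (words_with_peaks {..<card A - k} {})"
    (is "card ?X = _")
proof -
  let ?B = "{B. B \<subseteq> A \<and> card B = k}"
  let ?T = "SIGMA B : ?B. words_with_peaks B S \<times> words_with_peaks (A - B) {}"
  let ?f = "\<lambda>(B, xs, ys). xs @ ys"
  \<comment> \<open>All first words have length \<open>k\<close>, so the concatenation determines
    the cut.\<close>
  have "inj_on ?f ?T"
  proof (rule inj_onI)
    fix s t assume st: "s \<in> ?T" "t \<in> ?T" "?f s = ?f t"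
    obtain B xs ys B' xs' ys' where "s = (B, xs, ys)" "t = (B', xs', ys')"
      by (metis prod_cases3)
    moreover from this have "length xs = length xs'" "set xs = B" "set xs' = B'"
      using st words_with_peaksD(1,4)[of _ _ S] by auto
    ultimately show "s = t"
      using st(3) by simp
  qed
  moreover have "?f ` ?T = ?X"
  proof (intro equalityI subsetI)
    fix zs assume "zs \<in> ?f ` ?T"
    then obtain B xs ys where B: "B \<subseteq> A" "card B = k"
      and xs: "xs \<in> words_with_peaks B S" and ys: "ys \<in> words_with_peaks (A - B) {}"
      and zs: "zs = xs @ ys" by auto
    note D = words_with_peaksD[OF xs] words_with_peaksD[OF ys]
    have "zs \<in> permutations_of_set A"
      using D B zs by (intro permutations_of_setI) auto
    then show "zs \<in> ?X"
      using D peaks_append_no_peaks_iff[of xs ys S] B zs by auto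
  next
    fix zs assume zs: "zs \<in> ?X"
    define xs ys where "xs = take k zs" and "ys = drop k zs"
    have app: "zs = xs @ ys" by (simp add: xs_def ys_def)
    have perm: "set zs = A" "distinct zs"
      using zs by (auto dest: permutations_of_setD)
    have len: "length xs = k"
      using assms(2) perm distinct_card[of zs] by (simp add: xs_def)
    have "peaks xs = S" "peaks ys = {}"
      using zs peaks_append_no_peaks_iff[of xs ys S] by (auto simp: app len)
    moreover have "set ys = A - set xs" "distinct xs" "distinct ys" "set xs \<subseteq> A" "card (set xs) = k"
      using perm len distinct_card[of xs] by (auto simp: app)
    ultimately have "(set xs, xs, ys) \<in> ?T"
      by (auto intro: words_with_peaksI)
    then have "?f (set xs, xs, ys) \<in> ?f ` ?T" by (rule imageI)
    then show "zs \<in> ?f ` ?T" using app by simp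
  qed
  ultimately have "card ?X = card ?T"
    using card_image[of ?f ?T] by argo
  also have "\<dots> = (\<Sum>B\<in>?B. card (words_with_peaks B S \<times> words_with_peaks (A - B) {}))"
    using assms(1) by (intro card_SigmaI) simp_all
  also have "\<dots> = (\<Sum>B\<in>?B. card (words_with_peaks B S) * card (words_with_peaks (A - B) {}))"
    by (simp only: card_cartesian_product)
  also have "\<dots> = (\<Sum>B\<in>?B. card (words_with_peaks {..<k} S) * card (words_with_peaks {..<card A - k} {}))"
  proof (intro sum.cong refl)
    fix B assume B: "B \<in> ?B"
    have fin: "finite B" using B assms(1) finite_subset by blast
    have "card (words_with_peaks B S) = card (words_with_peaks {..<k} S)"
      by (rule card_words_with_peaks_cong) (use B fin in simp_all)
    moreover have "card (words_with_peaks (A - B) {}) = card (words_with_peaks {..<card A - k} {})"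
      by (rule card_words_with_peaks_cong) (use B fin assms(1) in \<open>simp_all add: card_Diff_subset\<close>)
    ultimately show "card (words_with_peaks B S) * card (words_with_peaks (A - B) {}) =
      card (words_with_peaks {..<k} S) * card (words_with_peaks {..<card A - k} {})" by simp
  qed
  also have "\<dots> = (card A choose k) * card (words_with_peaks {..<k} S) * card (words_with_peaks {..<card A - k} {})"
    using n_subsets[OF assms(1), of k] by simp
  finally show ?thesis .
qed

definition peak_count :: "nat set \<Rightarrow> nat \<Rightarrow> nat" where
  "peak_count S n = card (words_with_peaks {..<n} S)"

lemma peak_count_empty: "0 < n \<Longrightarrow> peak_count {} n = 2 ^ (n - 1)"
  unfolding peak_count_def by (subst card_words_with_no_peaks) auto

lemma peak_count_eq_0:
  assumes "\<And>xs. length xs = n \<Longrightarrow> peaks xs \<noteq> S"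
  shows "peak_count S n = 0"
proof -
  have "words_with_peaks {..<n} S = {}"
    using assms words_with_peaksD(3,4)[of _ "{..<n}" S] by fastforce
  then show ?thesis by (simp add: peak_count_def)
qed

text \<open>
  The recursion of Billey, Burdzy and Sagan: split a word after position \<open>k\<close> such that the
  second part has no peaks; peaks of the whole word other than those in \<open>S\<close> can then occur only
  at \<open>k\<close> or \<open>Suc k\<close>.
\<close>

lemma peak_count_recursion:
  assumes "S \<subseteq> {..<k}" "k < n"
  shows "(n choose k) * peak_count S k * 2 ^ (n - k - 1) =
           peak_count S n + peak_count (insert k S) n + peak_count (insert (Suc k) S) n"
proof -
  let ?W = "\<lambda>T. words_with_peaks {..<n} T"
  have "{zs \<in> permutations_of_set {..<n}. peaks zs \<subseteq> {k, Suc k} \<union> S \<and> peaks zs \<inter> {..<k} = S}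
      = ?W S \<union> (?W (insert k S) \<union> ?W (insert (Suc k) S))" (is "?X = _")
  proof (intro equalityI subsetI)
    fix zs assume zs: "zs \<in> ?X"
    then have "peaks zs = S \<union> (peaks zs \<inter> {k, Suc k})" by blast
    \<comment> \<open>This excludes the fourth case, in which both free positions are peaks.\<close>
    moreover have "\<not> (k \<in> peaks zs \<and> Suc k \<in> peaks zs)"
      using peaks_not_consecutive by blast
    ultimately have "peaks zs \<in> {S, insert k S, insert (Suc k) S}" by auto
    then show "zs \<in> ?W S \<union> (?W (insert k S) \<union> ?W (insert (Suc k) S))"
      using zs by (auto simp: words_with_peaks_def)
  next
    fix zs assume "zs \<in> ?W S \<union> (?W (insert k S) \<union> ?W (insert (Suc k) S))"
    then show "zs \<in> ?X" using assms by (auto simp: words_with_peaks_def)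
  qed
  moreover have "insert k S \<noteq> insert (Suc k) S" "insert k S \<noteq> S" "insert (Suc k) S \<noteq> S"
    using assms(1) by auto
  then have "?W (insert k S) \<inter> ?W (insert (Suc k) S) = {}"
    "?W S \<inter> (?W (insert k S) \<union> ?W (insert (Suc k) S)) = {}"
    unfolding words_with_peaks_def by blast+
  ultimately have "card ?X = card (?W S) + (card (?W (insert k S)) + card (?W (insert (Suc k) S)))"
    by (simp add: card_Un_disjoint)
  then show ?thesis
    using card_words_split[of "{..<n}" k S] assms(2) peak_count_empty[of "n - k"]
    by (simp add: peak_count_def)
qed

section \<open>Permutations as words\<close>

lemma card_perms_with_peaks: "card (perms_with_peaks S n) = peak_count S n"
proof -
  let ?f = "\<lambda>\<pi>. map \<pi> [1..<Suc n]"
  have peaks: "peaks (?f \<pi>) = peak_set n \<pi>" for \<pi>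
    by (auto simp: peaks_def peak_set_def nth_append Suc_diff_Suc numeral_2_eq_2 simp del: upt_Suc)
  have inj: "inj_on ?f (perms_with_peaks S n)"
  proof (rule inj_onI)
    fix \<pi> \<sigma> assume A: "\<pi> \<in> perms_with_peaks S n" "\<sigma> \<in> perms_with_peaks S n" "?f \<pi> = ?f \<sigma>"
    show "\<pi> = \<sigma>"
    proof
      fix i
      show "\<pi> i = \<sigma> i"
        using A by (cases "i \<in> {1..n}") (auto simp: perms_with_peaks_def permutes_def simp del: upt_Suc)
    qed
  qed
  have "?f ` perms_with_peaks S n = words_with_peaks {1..n} S"
  proof (intro equalityI subsetI)
    fix xs assume "xs \<in> ?f ` perms_with_peaks S n"
    then obtain \<pi> where \<pi>: "\<pi> permutes {1..n}" "peak_set n \<pi> = S" "xs = ?f \<pi>"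
      by (auto simp: perms_with_peaks_def)
    have "set xs = {1..n}"
      using permutes_image[OF \<pi>(1)] \<pi>(3) by (simp add: atLeastLessThanSuc_atLeastAtMost del: upt_Suc)
    moreover have "distinct xs"
      using permutes_inj_on[OF \<pi>(1)] \<pi>(3) by (simp add: distinct_map del: upt_Suc)
    ultimately show "xs \<in> words_with_peaks {1..n} S"
      using peaks \<pi> by (intro words_with_peaksI) auto
  next
    fix xs assume xs: "xs \<in> words_with_peaks {1..n} S"
    note D = words_with_peaksD[OF xs]
    \<comment> \<open>Outside \<open>{1..n}\<close> the value must be \<open>i\<close> itself, as
      \<open>permutes\<close> demands.\<close>
    define \<pi> where "\<pi> i = (if i \<in> {1..n} then xs ! (i - 1) else i)" for i
    have xs_eq: "xs = ?f \<pi>"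
      using D(4) by (intro nth_equalityI) (auto simp: \<pi>_def simp del: upt_Suc)
    have set_eq: "set [1..<Suc n] = {1..n}" by auto
    have "inj_on \<pi> {1..n}"
      using D(2) unfolding xs_eq distinct_map set_eq by blast
    moreover have "\<pi> ` {1..n} = {1..n}"
      using D(1) unfolding xs_eq set_map set_eq by blast
    ultimately have "\<pi> permutes {1..n}"
      by (intro bij_imp_permutes) (auto simp: bij_betw_def \<pi>_def)
    moreover have "peak_set n \<pi> = S"
      using peaks[of \<pi>] D(3) xs_eq by simp
    ultimately show "xs \<in> ?f ` perms_with_peaks S n"
      using xs_eq unfolding perms_with_peaks_def by blast
  qed
  then have "card (perms_with_peaks S n) = card (words_with_peaks {1..n} S)"
    using card_image[OF inj] by simp
  also have "\<dots> = peak_count S n"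
    unfolding peak_count_def by (rule card_words_with_peaks_cong) auto
  finally show ?thesis .
qed

section \<open>Polynomials for the peak counts\<close>

definition choose_poly :: "nat \<Rightarrow> real poly" where
  "choose_poly k = smult (1 / fact k) (\<Prod>i<k. [:- real i, 1:])"

lemma poly_choose_poly: "poly (choose_poly k) (real n) = real (n choose k)"
  unfolding binomial_gbinomial gbinomial_prod_rev choose_poly_def
  by (simp add: poly_prod atLeast0LessThan)

lemma degree_choose_poly_le: "degree (choose_poly k) \<le> k"
  unfolding choose_poly_def
  by (intro order.trans[OF degree_smult_le] order.trans[OF degree_prod_sum_le]) auto

text \<open>
  The exponents are arranged such that nothing truncates; \<open>n = 0\<close> is excluded because
  \<open>peak_count {} 0 = 1\<close> whereas \<open>peak_count {} n = 2 ^ (n - 1)\<close> for positive \<open>n\<close>.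
\<close>

definition counts_peaks :: "nat set \<Rightarrow> real poly \<Rightarrow> bool" where
  "counts_peaks S p \<longleftrightarrow> (\<forall>n>0. S \<subseteq> {..n} \<longrightarrow>
     real (peak_count S n) * 2 ^ (card S + 1) = poly p (real n) * 2 ^ n)"

lemma counts_peaksD:
  "counts_peaks S p \<Longrightarrow> 0 < n \<Longrightarrow> S \<subseteq> {..n} \<Longrightarrow>
     real (peak_count S n) * 2 ^ (card S + 1) = poly p (real n) * 2 ^ n"
  by (simp add: counts_peaks_def)

text \<open>The last position of a word is never a peak, so no word of length \<open>n\<close> has
  peak set \<open>S\<close>.\<close>

lemma counts_peaks_root:
  assumes "counts_peaks S p" "0 < n" "n \<in> S" "S \<subseteq> {..n}"
  shows "poly p (real n) = 0"
proof -
  have "peak_count S n = 0"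
    using assms(3) peaks_bounds by (intro peak_count_eq_0) blast
  then show ?thesis using counts_peaksD[OF assms(1,2,4)] by simp
qed

text \<open>This is the counting recursion solved for its last term. The coefficient 2 of
  \<open>p\<close> appears because \<open>S\<close> has one peak fewer than the two other
  sets.\<close>

lemma counts_peaks_insert:
  assumes "counts_peaks S p" "counts_peaks (insert k S) q" "S \<subseteq> {..<k}" "0 < k"
  shows "counts_peaks (insert (Suc k) S) (smult (poly p (real k)) (choose_poly k) - smult 2 p - q)"
  unfolding counts_peaks_def
proof (intro allI impI)
  fix n assume n: "0 < n" "insert (Suc k) S \<subseteq> {..n}"
  have fin: "finite S" using assms(3) finite_subset by blast
  have card: "card (insert k S) = Suc (card S)" "card (insert (Suc k) S) = Suc (card S)"
    using assms(3) by (auto intro!: card_insert_disjoint fin)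
  have k: "k < n" "S \<subseteq> {..n}" "insert k S \<subseteq> {..n}" "S \<subseteq> {..k}" using n assms(3) by auto
  define a b c where "a = real (peak_count S n)" and "b = real (peak_count (insert k S) n)"
    and "c = real (peak_count (insert (Suc k) S) n)"
  have "real (n choose k) * real (peak_count S k) * 2 ^ (n - k - 1) = a + b + c"
    using arg_cong[OF peak_count_recursion[OF assms(3) k(1)], of real]
    by (simp add: a_def b_def c_def)
  then have "c = real (n choose k) * real (peak_count S k) * 2 ^ (n - k - 1) - a - b"
    by simp
  then have "c * 2 ^ (card S + 2) =
      real (n choose k) * (real (peak_count S k) * 2 ^ (card S + 1)) * (2 ^ (n - k - 1) * 2)
        - 2 * (a * 2 ^ (card S + 1)) - b * 2 ^ (card S + 2)"
    by (simp only:) (simp add: algebra_simps)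
  also have "real (peak_count S k) * 2 ^ (card S + 1) = poly p (real k) * 2 ^ k"
    using assms(1,4) k(4) by (rule counts_peaksD)
  also have "a * 2 ^ (card S + 1) = poly p (real n) * 2 ^ n"
    unfolding a_def using assms(1) n(1) k(2) by (rule counts_peaksD)
  also have "b * 2 ^ (card S + 2) = poly q (real n) * 2 ^ n"
    using counts_peaksD[OF assms(2) n(1) k(3)] by (simp add: b_def card)
  \<comment> \<open>The powers of 2 from the two parts of the split combine to
    \<open>2 ^ n\<close>.\<close>
  also have "real (n choose k) * (poly p (real k) * 2 ^ k) * (2 ^ (n - k - 1) * 2) =
      poly p (real k) * real (n choose k) * 2 ^ (k + (n - k - 1) + 1)"
    by (simp add: power_add)
  also have "k + (n - k - 1) + 1 = n" using k(1) by simp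
  finally show "real (peak_count (insert (Suc k) S) n) * 2 ^ (card (insert (Suc k) S) + 1) =
      poly (smult (poly p (real k)) (choose_poly k) - smult 2 p - q) (real n) * 2 ^ n"
    by (simp add: c_def card poly_choose_poly algebra_simps)
qed

section \<open>Symmetry by adding peaks in increasing order\<close>

lemma counts_peaks_insert_binomial_transform:
  assumes p: "counts_peaks S p" "degree p \<le> m - 1" "S \<subseteq> {..m}" "m \<in> S \<or> m = 0"
    and sym: "\<And>j. j \<le> m \<Longrightarrow> binomial_transform (\<lambda>i. poly p (real i)) j = (-1) ^ m * poly p (real j)"
    and k: "m < k"
  shows "\<exists>q. counts_peaks (insert k S) q \<and> degree q \<le> k - 1 \<and>
           (\<forall>j<k. poly q (real j) =
              (-1) ^ (k + 1) * binomial_transform (\<lambda>i. poly p (real i)) j - poly p (real j))"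
  using Suc_leI[OF k]
proof (induction k rule: nat_induct_at_least)
  case base
  \<comment> \<open>Either \<open>m\<close> and \<open>Suc m\<close> would be consecutive peaks, or
    \<open>m = 0\<close> and position 1 would be a peak. So the zero polynomial counts, and by
    \<open>sym\<close> the claimed right-hand side is 0 as well.\<close>
  have "peaks xs \<noteq> insert (Suc m) S" for xs
    using p(4) peaks_not_consecutive[of m xs] peaks_bounds[of 1 xs] by auto
  then have "counts_peaks (insert (Suc m) S) 0"
    by (simp add: counts_peaks_def peak_count_eq_0)
  moreover have "0 = (-1) ^ (Suc m + 1) * binomial_transform (\<lambda>i. poly p (real i)) j - poly p (real j)"
    if "j < Suc m" for j
    using sym[of j] that by simp
  ultimately show ?case by (intro exI[of _ 0]) simp
next
  case (Suc k)
  from Suc.IH obtain q where q: "counts_peaks (insert k S) q" "degree q \<le> k - 1"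
    and q_eq: "\<And>j. j < k \<Longrightarrow> poly q (real j) =
      (-1) ^ (k + 1) * binomial_transform (\<lambda>i. poly p (real i)) j - poly p (real j)"
    by blast
  have k: "0 < k" "S \<subseteq> {..<k}" using Suc.hyps p(3) by auto
  define r where "r = smult (poly p (real k)) (choose_poly k) - smult 2 p - q"
  have "counts_peaks (insert (Suc k) S) r"
    unfolding r_def using p(1) q(1) k(2,1) by (rule counts_peaks_insert)
  moreover have "degree r \<le> Suc k - 1"
    unfolding r_def using p(2) q(2) Suc.hyps
    by (intro degree_diff_le order.trans[OF degree_smult_le]) (auto intro: degree_choose_poly_le)
  moreover have "poly r (real j) = (-1) ^ (Suc k + 1) * binomial_transform (\<lambda>i. poly p (real i)) j
      - poly p (real j)" if "j < Suc k" for j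
  proof (cases "j < k")
    \<comment> \<open>Below \<open>k\<close> the binomial coefficient vanishes, so \<open>r\<close>
      equals \<open>- 2 * p - q\<close> there; inserting \<open>q_eq\<close> flips the sign of the
      transform and leaves \<open>- p\<close>.\<close>
    case True
    then show ?thesis
      using q_eq[OF True] by (simp add: r_def poly_choose_poly binomial_eq_0)
  next
    case False
    then have [simp]: "j = k" using that by simp
    \<comment> \<open>At \<open>k\<close> the binomial coefficient is 1, so \<open>r\<close> takes
      the value of \<open>p - 2 * p = - p\<close>, and the transform of \<open>p\<close> vanishes
      because its degree is below \<open>k\<close>.\<close>
    have "poly q (real k) = 0"
      using q(1) k by (intro counts_peaks_root[of "insert k S"]) auto
    moreover have "binomial_transform (\<lambda>i. poly p (real i)) k = 0"
      using p(2) Suc.hyps by (intro binomial_transform_poly_eq_0) linarith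
    ultimately show ?thesis by (simp add: r_def poly_choose_poly)
  qed
  ultimately show ?case by blast
qed

text \<open>The variable \<open>m\<close> stands for \<open>Max S\<close> but is 0 for the empty
  set, where the induction starts with the constant polynomial 1.\<close>

lemma ex_counts_peaks_symmetric:
  assumes "finite S" "0 \<notin> S"
  shows "\<exists>p m. counts_peaks S p \<and> degree p \<le> m - 1 \<and> S \<subseteq> {..m} \<and> (m \<in> S \<or> m = 0 \<and> S = {}) \<and>
           (\<forall>j\<le>m. binomial_transform (\<lambda>i. poly p (real i)) j = (-1) ^ m * poly p (real j))"
  using assms
proof (induction S rule: finite_linorder_max_induct)
  case empty
  have "counts_peaks {} 1"
    by (auto simp: counts_peaks_def peak_count_empty simp flip: power_Suc2)
  then show ?case by (intro exI[of _ 1] exI[of _ 0]) simp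
next
  case (insert k S)
  then obtain p m where p: "counts_peaks S p" "degree p \<le> m - 1" "S \<subseteq> {..m}" "m \<in> S \<or> m = 0 \<and> S = {}"
    and sym: "\<And>j. j \<le> m \<Longrightarrow> binomial_transform (\<lambda>i. poly p (real i)) j = (-1) ^ m * poly p (real j)"
    by auto
  have k: "m < k" "S \<subseteq> {..k}" using insert.hyps insert.prems p(4) by auto
  define T where "T = binomial_transform (\<lambda>i. poly p (real i))"
  obtain q where q: "counts_peaks (insert k S) q" "degree q \<le> k - 1"
    and q_eq: "\<And>j. j < k \<Longrightarrow> poly q (real j) = (-1) ^ (k + 1) * T j - poly p (real j)"
    using counts_peaks_insert_binomial_transform[OF p(1-3) _ sym k(1)] p(4) unfolding T_def by blast
  have "binomial_transform (\<lambda>i. poly q (real i)) j = (-1) ^ k * poly q (real j)" if "j \<le> k" for j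
  proof (cases "j = k")
    case True
    have "poly q (real k) = 0"
      using q(1) k by (intro counts_peaks_root[of "insert k S"]) auto
    then show ?thesis
      using binomial_transform_poly_eq_0[of q k] q(2) k(1) True by simp
  next
    case False
    with that have "j < k" by simp
    \<comment> \<open>The transform at \<open>j\<close> reads only arguments up to \<open>j\<close>,
      and \<open>q_eq\<close> covers all of these.\<close>
    have "binomial_transform (\<lambda>i. poly q (real i)) j =
        binomial_transform (\<lambda>i. (-1) ^ (k + 1) * T i - poly p (real i)) j"
      using \<open>j < k\<close> q_eq by (intro binomial_transform_cong) auto
    \<comment> \<open>By the involution, transforming the formula for \<open>q\<close> exchanges
      \<open>p\<close> and \<open>T\<close>.\<close>
    also have "\<dots> = (-1) ^ (k + 1) * poly p (real j) - T j"
      by (simp only: binomial_transform_diff binomial_transform_scale)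
         (simp add: T_def binomial_transform_involution)
    also have "\<dots> = (-1) ^ k * poly q (real j)"
      using q_eq[OF \<open>j < k\<close>] by (cases "even k") auto
    finally show ?thesis .
  qed
  then show ?case using q k(2) by (intro exI[of _ q] exI[of _ k]) auto
qed

section \<open>Uniqueness of the peak polynomial and conclusion\<close>

text \<open>Otherwise the nonzero polynomial \<open>p - q\<close> would have infinitely many
  roots.\<close>

lemma poly_eqI_real_of_nat:
  fixes p q :: "real poly"
  assumes "\<And>n. n \<ge> N \<Longrightarrow> poly p (real n) = poly q (real n)"
  shows "p = q"
proof (rule ccontr)
  assume "p \<noteq> q"
  then have "finite {x. poly (p - q) x = 0}"
    by (intro poly_roots_finite) simp
  moreover have "real ` {N..} \<subseteq> {x. poly (p - q) x = 0}"
    using assms by auto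
  moreover have "infinite (real ` {N..})"
    by (simp add: finite_image_iff infinite_Ici)
  ultimately show False using finite_subset by blast
qed

lemma peak_poly_eqI:
  assumes "counts_peaks S p" "S \<noteq> {}" "S \<subseteq> {2..}" "finite S"
  shows "peak_poly S = p"
proof -
  have Max: "Max S \<in> S" "2 \<le> Max S" "S \<subseteq> {2..Max S}"
    using assms Max_in[of S] by (auto simp: subset_iff)
  \<comment> \<open>\<open>S\<close> lies in \<open>{2..Max S}\<close>, which has
    \<open>Max S - 1\<close> elements. This keeps the exponent \<open>n - card S - 1\<close> from
    truncating.\<close>
  have "card S + 1 \<le> Max S"
    using card_mono[OF _ Max(3)] Max(2) by simp
  have count: "real (card (perms_with_peaks S n)) = poly p (real n) * 2 ^ (n - card S - 1)"
    if "n \<ge> Max S" for n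
  proof -
    have "real (peak_count S n) * 2 ^ (card S + 1) = poly p (real n) * 2 ^ n"
      using assms(1) Max that by (intro counts_peaksD) auto
    also have "n = (n - card S - 1) + (card S + 1)"
      using that \<open>card S + 1 \<le> Max S\<close> by simp
    then have "(2::real) ^ n = 2 ^ (n - card S - 1) * 2 ^ (card S + 1)"
      by (metis power_add)
    finally show ?thesis by (simp add: card_perms_with_peaks)
  qed
  show ?thesis
    unfolding peak_poly_def
  proof (rule the_equality)
    fix q :: "real poly"
    assume q: "\<forall>n\<ge>Max S. real (card (perms_with_peaks S n)) = poly q (real n) * 2 ^ (n - card S - 1)"
    show "q = p"
    proof (rule poly_eqI_real_of_nat)
      fix n assume "n \<ge> Max S"
      with q count have "poly q (real n) * 2 ^ (n - card S - 1) = poly p (real n) * 2 ^ (n - card S - 1)"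
        by metis
      then show "poly q (real n) = poly p (real n)" by simp
    qed
  qed (use count in blast)
qed

theorem theorem4p3:
  fixes S :: "nat set" and j :: nat
  assumes "S \<noteq> {}" and "admissible S" and "j \<le> Max S"
  shows "(fwd_diff ^^ j) (poly (peak_poly S)) 0
           = (-1) ^ (Max S + j) * poly (peak_poly S) (real j)"
proof -
  \<comment> \<open>Admissibility makes \<open>S\<close> the peak set of some permutation, and peaks
    exceed 1.\<close>
  have S: "finite S" "S \<subseteq> {2..}"
    using assms(2) by (auto simp: admissible_def perms_with_peaks_def peak_set_def)
  then have "0 \<notin> S" by auto
  with S(1) obtain p m where p: "counts_peaks S p" and m: "S \<subseteq> {..m}" "m \<in> S \<or> m = 0 \<and> S = {}"
    and sym: "\<forall>j\<le>m. binomial_transform (\<lambda>i. poly p (real i)) j = (-1) ^ m * poly p (real j)"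
    using ex_counts_peaks_symmetric[of S] by blast
  have "Max S = m"
    using S(1) m assms(1) by (intro Max_eqI) auto
  moreover have "peak_poly S = p"
    using p assms(1) S(2,1) by (rule peak_poly_eqI)
  \<comment> \<open>At the point 0 the iterated difference is \<open>(-1) ^ j\<close> times the
    transform of \<open>p\<close>, to which \<open>sym\<close> applies.\<close>
  ultimately show ?thesis
    using sym assms(3) by (simp add: fwd_diff_funpow_eq_binomial_transform power_add)
qed

end
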